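(* Let $P_1,P_2,\dots$ be independent p-values and suppose the global null holds, i.e. $\pi_0=1$, so that every $P_i$ has the $\mathrm{Unif}[0,1]$ distribution. Let $\hat\pi_{0,BH}$ be the Benjamini–Hochberg estimator of $\pi_0$ computed from $P_1,\dots,P_n$. Then $\hat\pi_{0,BH}\to 1$ almost surely as $n\to\infty$.
   Context: The Benjamini–Hochberg (BH) estimator of the proportion $\pi_0$ of true null hypotheses is defined as follows. Let $P_{(1)}\le\dots\le P_{(n)}$ be the ordered values of $P_1,\dots,P_n$. For $i=1,\dots,n$ set $S_i=\dfrac{1-P_{(i)}}{n+1-i}$. Let $j=\inf\{i\ge 2: S_i<S_{i-1}\}$ (with $j=n$ if no such $i\le n$ exists). Put $\hat n_0=\min\left(\left[\tfrac{1}{S_j}+1\right],\,n\right)$, where $[\cdot]$ is the integer part, and $\hat\pi_{0,BH}=\hat n_0/n$. *)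

theory Defs
  imports "HOL-Probability.Probability"
begin

text \<open>
  The p-values are \<open>p 1, \<dots>, p n\<close>; the value \<open>p 0\<close> is never used.
  Lists are indexed from 0, hence the shift in the order statistic.
\<close>

definition order_stat :: "nat \<Rightarrow> (nat \<Rightarrow> real) \<Rightarrow> nat \<Rightarrow> real" where
  "order_stat n p i = sort (map p [1..<n+1]) ! (i - 1)"

definition BH_slope :: "nat \<Rightarrow> (nat \<Rightarrow> real) \<Rightarrow> nat \<Rightarrow> real" where
  "BH_slope n p i = (1 - order_stat n p i) / (real n + 1 - real i)"

definition BH_index :: "nat \<Rightarrow> (nat \<Rightarrow> real) \<Rightarrow> nat" where
  "BH_index n p =
     (if \<exists>i\<in>{2..n}. BH_slope n p i < BH_slope n p (i - 1)
      then Inf {i\<in>{2..n}. BH_slope n p i < BH_slope n p (i - 1)}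
      else n)"

text \<open>
  If the slope vanishes (which for p-values in \<open>[0,1]\<close> means that some p-value equals 1),
  then \<open>1 / S = \<infinity>\<close> and the minimum is \<open>n\<close>; this case is separated because
  \<open>1 / 0 = 0\<close> in HOL.
\<close>

definition BH_n0 :: "nat \<Rightarrow> (nat \<Rightarrow> real) \<Rightarrow> int" where
  "BH_n0 n p =
     (let S = BH_slope n p (BH_index n p)
      in if S = 0 then int n else min \<lfloor>1 / S + 1\<rfloor> (int n))"

definition BH_pi0 :: "nat \<Rightarrow> (nat \<Rightarrow> real) \<Rightarrow> real" where
  "BH_pi0 n p = real_of_int (BH_n0 n p) / real n"

end

theory Submission
  imports Defs
begin

text \<open>
  As long as the slopes do not decrease, neighbouring order statistics are close together, so it
  suffices to find one gap longer than \<open>2 / n\<close> among the smallest \<open>e n\<close> p-values. For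
  \<open>4 ^ k \<le> n < 4 ^ (k + 1)\<close> such a gap is looked for among \<open>2 ^ k\<close> disjoint cells of length
  \<open>2 / 4 ^ k\<close> placed just above \<open>1 / 2 ^ k\<close>. A cell which stays empty up to time
  \<open>4 ^ (k + 1)\<close> serves for all \<open>n\<close> in the block. As the emptiness events are negatively
  correlated, Chebyshev's inequality bounds the probability that no cell stays empty by
  \<open>O(2 ^ -k)\<close>; by Markov's inequality the cells lie within the smallest \<open>e n\<close> p-values up
  to an event of the same order, and Borel--Cantelli applies along the blocks.
\<close>

section \<open>Order statistics through counting\<close>

text \<open>The entries at most \<open>u\<close> of a sorted list form an initial segment, so a
  position lies in it exactly when it is below the length of that segment.\<close>

lemma sorted_nth_le_iff:
  fixes xs :: "'a::linorder list"
  assumes "sorted xs" "i < length xs"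
  shows "xs ! i \<le> u \<longleftrightarrow> i < length (filter (\<lambda>x. x \<le> u) xs)"
  using assms
proof (induction xs arbitrary: i)
  case (Cons a xs)
  show ?case
  proof (cases "a \<le> u")
    case True
    then show ?thesis using Cons by (cases i) auto
  next
    case False
    then have "\<forall>x\<in>set (a # xs). \<not> x \<le> u" using Cons.prems by auto
    then have "filter (\<lambda>x. x \<le> u) (a # xs) = []" "\<not> (a # xs) ! i \<le> u"
      using nth_mem[OF Cons.prems(2)] by (auto simp: filter_empty_conv)
    then show ?thesis by simp
  qed
qed simp

text \<open>Sorting preserves the number of values at most \<open>u\<close>, so order statistics can
  be handled by counting. Ranks start at 1, hence \<open>\<le>\<close> in place of the
  \<open><\<close> for list positions.\<close>

lemma order_stat_le_iff:
  assumes "i \<in> {1..n}"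
  shows "order_stat n p i \<le> u \<longleftrightarrow> i \<le> card {l \<in> {1..n}. p l \<le> u}"
proof -
  have "length (filter (\<lambda>x. x \<le> u) (sort (map p [1..<n+1])))
      = length (filter (\<lambda>l. p l \<le> u) [1..<n+1])"
    by (simp add: filter_sort filter_map comp_def)
  also have "\<dots> = card {l \<in> {1..n}. p l \<le> u}"
    by (subst distinct_length_filter) (auto intro!: arg_cong[of _ _ card])
  finally have len: "length (filter (\<lambda>x. x \<le> u) (sort (map p [1..<n+1])))
      = card {l \<in> {1..n}. p l \<le> u}" .
  have "i - 1 < length (sort (map p [1..<n+1]))" using assms by auto
  from sorted_nth_le_iff[OF sorted_sort this, of u] show ?thesis
    unfolding order_stat_def len using assms by auto
qed

lemma order_stat_mem:
  assumes "i \<in> {1..n}"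
  shows "order_stat n p i \<in> p ` {1..n}"
proof -
  have "i - 1 < length (sort (map p [1..<n+1]))" using assms by auto
  from nth_mem[OF this] show ?thesis
    unfolding order_stat_def by (auto simp: image_iff)
qed

section \<open>Deterministic bounds for the estimator\<close>

lemma BH_pi0_le_1: "n > 0 \<Longrightarrow> BH_pi0 n p \<le> 1"
  by (auto simp: BH_pi0_def BH_n0_def Let_def)

text \<open>
  A gap longer than \<open>2 / n\<close> between neighbouring order statistics forces the slope to decrease
  there, and up to such an index the slopes are at most \<open>1 / ((1 - e) n)\<close>.
\<close>
lemma BH_pi0_ge:
  fixes p :: "nat \<Rightarrow> real" and e u :: real
  assumes p: "\<And>i. i \<in> {1..n} \<Longrightarrow> p i \<in> {0..1}"
    and n: "n > 0" and e: "e \<le> 1/2"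
    and left: "\<exists>i\<in>{1..n}. p i \<le> u"
    and gap: "\<And>i. i \<in> {1..n} \<Longrightarrow> p i \<notin> {u<..u + 2 / n}"
    and few: "card {i \<in> {1..n}. p i \<le> u} \<le> e * n"
  shows "BH_pi0 n p \<ge> 1 - e"
proof -
  \<comment> \<open>The gap lies between the order statistics of ranks \<open>c\<close> and
    \<open>c + 1\<close>.\<close>
  define c where "c = card {i \<in> {1..n}. p i \<le> u}"
  have c_e: "real c \<le> e * n" using few by (simp add: c_def)
  have c1: "c \<ge> 1" using left by (auto simp: c_def Suc_le_eq card_gt_0_iff)
  have "e * n \<le> 1/2 * n" using e by (intro mult_right_mono) auto
  with c_e n have "real c < real n" by linarith
  then have cn: "c < n" by simp
  let ?q = "order_stat n p" and ?S = "BH_slope n p"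
  have q01: "?q i \<in> {0..1}" if i: "i \<in> {1..n}" for i
  proof -
    obtain l where "l \<in> {1..n}" "?q i = p l" using order_stat_mem[OF i, of p] by blast
    then show ?thesis using p[of l] by simp
  qed
  have q_c: "?q c \<le> u" using c1 cn by (subst order_stat_le_iff) (auto simp: c_def)
  have "\<not> ?q (c + 1) \<le> u" using cn by (subst order_stat_le_iff) (auto simp: c_def)
  moreover have "?q (c + 1) \<notin> {u<..u + 2 / n}"
    using order_stat_mem[of "c + 1" n p] gap cn by auto
  ultimately have "?q (c + 1) > u + 2 / n" by auto
  with q_c have q_gap: "?q (c + 1) - ?q c > 2 / n" by linarith
  \<comment> \<open>Since \<open>e \<le> 1/2\<close>, the factor \<open>n - c\<close> is at least
    \<open>n / 2\<close>. Multiplied by a gap longer than \<open>2 / n\<close> it exceeds 1, which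
    bounds the numerator of the slope at \<open>c + 1\<close>. This fixes the constant 2 in the
    gap.\<close>
  have half: "real n - real c \<ge> n / 2" using c_e \<open>e * n \<le> 1/2 * n\<close> by linarith
  have "1 - ?q (c + 1) \<le> 1" using q01[of "c + 1"] cn by auto
  also have "1 \<le> (real n - c) * (2 / n)" using half n by (simp add: field_simps)
  also have "\<dots> < (real n - c) * (?q (c + 1) - ?q c)"
    using q_gap cn by (intro mult_strict_left_mono) auto
  \<comment> \<open>This is the decrease of the slope at \<open>c + 1\<close> after clearing the
    denominators \<open>n - c\<close> and \<open>n + 1 - c\<close>.\<close>
  finally have "(1 - ?q (c + 1)) * (real n + 1 - c) < (1 - ?q c) * (real n - c)"
    by (simp add: algebra_simps)
  then have desc: "?S (c + 1) < ?S (c + 1 - 1)"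
    using cn by (simp add: BH_slope_def field_simps)
  define J where "J = {i \<in> {2..n}. ?S i < ?S (i - 1)}"
  define j where "j = BH_index n p"
  \<comment> \<open>The search for a decrease starts at index 2; a p-value at most \<open>u\<close>
    gives \<open>c \<ge> 1\<close>, so \<open>c + 1\<close> is in its range.\<close>
  have memJ: "c + 1 \<in> J" using desc c1 cn by (auto simp: J_def)
  then have "\<exists>i\<in>{2..n}. ?S i < ?S (i - 1)" unfolding J_def by blast
  then have "j = Inf J" unfolding j_def BH_index_def J_def by (rule if_P)
  then have jJ: "j \<in> J" and j_le: "j \<le> c + 1"
    using memJ Inf_nat_def1[of J] by (auto intro: cInf_lower)
  then have j: "2 \<le> j" "j \<le> n" "?S j < ?S (j - 1)" by (auto simp: J_def)
  have S_nonneg: "?S j \<ge> 0" using q01[of j] j by (auto simp: BH_slope_def)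
  have pos: "(1 - e) * n > 0" using e n by simp
  \<comment> \<open>The slope at \<open>j\<close> lies below the one at \<open>j - 1\<close>, whose
    numerator is at most 1 and whose denominator stays above \<open>(1 - e) * n\<close> because
    \<open>j \<le> c + 1\<close>.\<close>
  have "?S (j - 1) = (1 - ?q (j - 1)) / (real n + 2 - j)"
    using j by (simp add: BH_slope_def of_nat_diff)
  also have "\<dots> \<le> 1 / (real n + 2 - j)"
  proof (rule divide_right_mono)
    have "j - 1 \<in> {1..n}" using j by auto
    from q01[OF this] show "1 - ?q (j - 1) \<le> 1" by simp
  qed (use j in simp)
  also have "\<dots> \<le> 1 / ((1 - e) * n)"
  proof (rule divide_left_mono)
    have "real j \<le> real c + 1" using j_le by linarith
    then show "(1 - e) * n \<le> real n + 2 - j" using c_e by (simp add: algebra_simps)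
    then show "0 < (real n + 2 - j) * ((1 - e) * n)" using pos by (intro mult_pos_pos[OF _ pos]) linarith
  qed simp
  finally have S_le: "?S j \<le> 1 / ((1 - e) * n)" using j by linarith
  have le_n: "(1 - e) * n \<le> n" using c_e by (simp add: algebra_simps)
  have "real_of_int (BH_n0 n p) \<ge> (1 - e) * n"
  proof (cases "?S j = 0")
    case True
    with le_n show ?thesis by (simp add: BH_n0_def j_def)
  next
    case False
    then have "?S j > 0" using S_nonneg by simp
    then have "(1 - e) * n \<le> 1 / ?S j" using S_le pos by (simp add: field_simps)
    \<comment> \<open>Adding 1 before taking the integer part absorbs the rounding loss.\<close>
    also have "\<dots> \<le> real_of_int \<lfloor>1 / ?S j + 1\<rfloor>" by linarith
    finally have "(1 - e) * n \<le> real_of_int \<lfloor>1 / ?S j + 1\<rfloor>" .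
    with le_n False show ?thesis by (simp add: BH_n0_def j_def Let_def min_def)
  qed
  then show ?thesis using n by (simp add: BH_pi0_def field_simps)
qed

section \<open>A second moment bound\<close>

text \<open>Chebyshev's inequality for the number \<open>X\<close> of events that occur: negative
  correlation makes the variance at most the mean, and \<open>X = 0\<close> is a deviation by the
  whole mean.\<close>

lemma (in prob_space) prob_no_event_le:
  fixes F :: "'i \<Rightarrow> 'a set" and q :: real
  assumes A: "finite A" "A \<noteq> {}" and q: "q > 0"
    and F: "\<And>a. a \<in> A \<Longrightarrow> F a \<in> events"
    and prob_F: "\<And>a. a \<in> A \<Longrightarrow> prob (F a) = q"
    and neg: "\<And>a b. a \<in> A \<Longrightarrow> b \<in> A \<Longrightarrow> a \<noteq> b \<Longrightarrow> prob (F a \<inter> F b) \<le> q\<^sup>2"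
  shows "prob {\<omega>\<in>space M. \<forall>a\<in>A. \<omega> \<notin> F a} \<le> 1 / (card A * q)"
proof -
  define X :: "'a \<Rightarrow> real" where "X = (\<lambda>\<omega>. \<Sum>a\<in>A. indicator (F a) \<omega>)"
  have ind [measurable]: "(indicator (F a) :: 'a \<Rightarrow> real) \<in> borel_measurable M" if "a \<in> A" for a
    using F[OF that] by simp
  have X_sq: "X \<omega> ^ 2 = (\<Sum>a\<in>A. \<Sum>b\<in>A. indicator (F a \<inter> F b) \<omega>)" for \<omega>
    by (simp add: X_def power2_eq_square sum_product indicator_inter_arith)
  have int1: "integrable M (indicator (F a) :: 'a \<Rightarrow> real)" if "a \<in> A" for a
    using F[OF that] by (simp add: emeasure_eq_measure)
  have int2: "integrable M (indicator (F a \<inter> F b) :: 'a \<Rightarrow> real)" if "a \<in> A" "b \<in> A" for a b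
    using F[OF that(1)] F[OF that(2)] by (simp add: emeasure_eq_measure)
  have X_meas: "X \<in> borel_measurable M" unfolding X_def by measurable
  have int_X: "integrable M X" unfolding X_def using int1 by simp
  have int_X2: "integrable M (\<lambda>\<omega>. (X \<omega>)\<^sup>2)" unfolding X_sq using int2 by simp
  let ?K = "real (card A)"
  have K: "?K > 0" using A by (simp add: card_gt_0_iff)
  have EX: "expectation X = ?K * q"
    unfolding X_def using int1 F prob_F by (simp add: sets.sets_into_space[THEN Int_absorb2])
  have "expectation (\<lambda>\<omega>. (X \<omega>)\<^sup>2) = (\<Sum>a\<in>A. \<Sum>b\<in>A. prob (F a \<inter> F b))"
    unfolding X_sq using int2 F
    by (simp add: Bochner_Integration.integral_sum sets.sets_into_space[THEN Int_absorb2])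
  \<comment> \<open>The diagonal terms equal \<open>q\<close> and the others are at most the square
    of \<open>q\<close>; the square is also added on the diagonal so that it cancels against the
    squared mean.\<close>
  also have "\<dots> \<le> (\<Sum>a\<in>A. \<Sum>b\<in>A. (if b = a then q else 0) + q\<^sup>2)"
    using neg prob_F q by (intro sum_mono) (auto intro: order_trans)
  also have "\<dots> = ?K * q + ?K\<^sup>2 * q\<^sup>2"
    using A by (simp add: sum.distrib power2_eq_square algebra_simps)
  finally have var: "variance X \<le> ?K * q"
    using variance_eq[OF int_X int_X2] by (simp add: EX power_mult_distrib)
  have "prob {\<omega>\<in>space M. \<forall>a\<in>A. \<omega> \<notin> F a} \<le> prob {\<omega>\<in>space M. ?K * q \<le> \<bar>X \<omega> - expectation X\<bar>}"
    using X_meas K q by (intro finite_measure_mono) (auto simp: EX, auto simp: X_def)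
  also have "\<dots> \<le> variance X / (?K * q)\<^sup>2"
    using X_meas int_X2 K q by (intro Chebyshev_inequality) auto
  also have "\<dots> \<le> ?K * q / (?K * q)\<^sup>2" using var by (intro divide_right_mono) auto
  also have "\<dots> = 1 / (?K * q)" by (simp add: power2_eq_square)
  finally show ?thesis .
qed

section \<open>Independent uniform p-values\<close>

locale iid_uniform = prob_space M for M :: "'a measure" +
  fixes P :: "nat \<Rightarrow> 'a \<Rightarrow> real"
  assumes indep: "indep_vars (\<lambda>_. borel) P {1..}"
    and distr_P: "\<And>i. i \<ge> 1 \<Longrightarrow> distr M borel (P i) = uniform_measure lborel {0..1}"
begin

lemma P_measurable [measurable]: "i \<ge> 1 \<Longrightarrow> P i \<in> borel_measurable M"
  using indep by (auto simp: indep_vars_def)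

lemma prob_P_in:
  assumes "i \<ge> 1" and [measurable]: "D \<in> sets borel"
  shows "prob {\<omega>\<in>space M. P i \<omega> \<in> D} = measure lborel ({0..1} \<inter> D)"
proof -
  have "prob {\<omega>\<in>space M. P i \<omega> \<in> D} = measure (distr M borel (P i)) D"
    using assms by (subst measure_distr) (auto intro!: arg_cong[of _ _ prob])
  also have "\<dots> = measure lborel ({0..1} \<inter> D)"
    unfolding distr_P[OF assms(1)] by (subst measure_uniform_measure) auto
  finally show ?thesis .
qed

text \<open>Independence multiplies the probabilities of missing \<open>D\<close>. The set is
  arbitrary so as to cover a half-line, one cell and a union of two cells.\<close>

lemma prob_all_notin:
  assumes D [measurable]: "D \<in> sets borel"
  shows "prob {\<omega>\<in>space M. \<forall>i\<in>{1..N}. P i \<omega> \<notin> D} = (1 - measure lborel ({0..1} \<inter> D)) ^ N"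
\<comment> \<open>For \<open>N = 0\<close> the intersection used below would be \<open>UNIV\<close>
  rather than \<open>space M\<close>.\<close>
proof (cases "N = 0")
  case True
  then show ?thesis by (simp add: prob_space)
next
  case False
  have "{\<omega>\<in>space M. \<forall>i\<in>{1..N}. P i \<omega> \<notin> D} = (\<Inter>i\<in>{1..N}. P i -` (- D) \<inter> space M)"
    using False by auto
  also have "prob \<dots> = (\<Prod>i\<in>{1..N}. prob (P i -` (- D) \<inter> space M))"
    using False by (intro indep_varsD[OF indep]) auto
  also have "\<dots> = (\<Prod>i\<in>{1..N}. 1 - measure lborel ({0..1} \<inter> D))"
  proof (rule prod.cong)
    fix i assume i: "i \<in> {1..N}"
    have "P i -` (- D) \<inter> space M = space M - {\<omega>\<in>space M. P i \<omega> \<in> D}" by auto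
    also have "prob \<dots> = 1 - prob {\<omega>\<in>space M. P i \<omega> \<in> D}"
      using i by (intro prob_compl) auto
    finally show "prob (P i -` (- D) \<inter> space M) = 1 - measure lborel ({0..1} \<inter> D)"
      using i by (simp add: prob_P_in)
  qed simp
  finally show ?thesis by simp
qed

lemma AE_P_in: "AE \<omega> in M. \<forall>i\<in>{1..}. P i \<omega> \<in> {0..1}"
proof -
  have "AE \<omega> in M. P i \<omega> \<in> {0..1}" if "i \<ge> 1" for i
  proof -
    have "prob {\<omega>\<in>space M. P i \<omega> \<in> {0..1}} = 1" using that by (subst prob_P_in) auto
    from AE_prob_1[OF this] show ?thesis by auto
  qed
  then show ?thesis by (intro AE_ball_countable') auto
qed

section \<open>Borel--Cantelli along the blocks\<close>

text \<open>A geometric bound is summable, so Borel--Cantelli applies; the threshold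
  \<open>m\<close> leaves room for estimates valid only for large \<open>k\<close>.\<close>

lemma AE_eventually_not:
  assumes [measurable]: "\<And>k. Measurable.pred M (Q k)"
    and le: "\<And>k. k \<ge> m \<Longrightarrow> prob {\<omega>\<in>space M. Q k \<omega>} \<le> C / 2 ^ k"
  shows "AE \<omega> in M. \<forall>\<^sub>F k in sequentially. \<not> Q k \<omega>"
proof -
  have "summable (\<lambda>k. C * (1/2) ^ k)" by (intro summable_mult summable_geometric) simp
  then have "summable (\<lambda>k. prob {\<omega>\<in>space M. Q k \<omega>})"
    by (rule summable_comparison_test[rotated]) (use le in \<open>auto simp: power_one_over divide_simps\<close>)
  then have "AE \<omega> in M. \<forall>\<^sub>F k in sequentially. \<omega> \<in> space M - {\<omega>\<in>space M. Q k \<omega>}"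
    by (intro borel_cantelli_AE1) (auto simp: emeasure_eq_measure)
  then show ?thesis
    by (rule AE_mp) (auto intro!: AE_I2 elim: eventually_mono)
qed

text \<open>Provides a p-value below all cells. It is found by the first time \<open>4 ^ k\<close>
  of the block and persists for later \<open>n\<close>; the failure probability is at most
  \<open>exp (- (2 ^ k))\<close>.\<close>

lemma AE_eventually_small_point:
  "AE \<omega> in M. \<forall>\<^sub>F k in sequentially. \<exists>i\<in>{1..4 ^ k}. P i \<omega> \<le> 1 / 2 ^ k"
proof -
  have "AE \<omega> in M. \<forall>\<^sub>F k in sequentially. \<not> (\<forall>i\<in>{1..4 ^ k}. P i \<omega> \<notin> {..1 / 2 ^ k})"
  proof (rule AE_eventually_not)
    fix k :: nat
    have "{0..1} \<inter> {..1 / 2 ^ k} = {0..1 / 2 ^ k :: real}" by (auto intro: order_trans)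
    then have "prob {\<omega>\<in>space M. \<forall>i\<in>{1..4 ^ k}. P i \<omega> \<notin> {..1 / 2 ^ k}} = (1 - 1 / 2 ^ k) ^ 4 ^ k"
      by (subst prob_all_notin) auto
    also have "\<dots> \<le> exp (- (1 / 2 ^ k)) ^ 4 ^ k"
      using exp_ge_add_one_self[of "- (1 / 2 ^ k)"] by (intro power_mono) auto
    also have "\<dots> = exp (- (2 ^ k))"
      by (simp add: exp_of_nat_mult[symmetric] power_mult_distrib[symmetric] field_simps)
    also have "\<dots> \<le> 1 / 2 ^ k"
    proof -
      have "(2::real) ^ k \<le> exp (2 ^ k)" using exp_ge_add_one_self[of "(2::real) ^ k"] by linarith
      then show ?thesis by (simp add: exp_minus field_simps)
    qed
    finally show "prob {\<omega>\<in>space M. \<forall>i\<in>{1..4 ^ k}. P i \<omega> \<notin> {..1 / 2 ^ k}} \<le> 1 / 2 ^ k" .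
  qed measurable
  then show ?thesis by simp
qed

text \<open>By the end of the block a cell is expected to hold
  \<open>4 ^ Suc k * (2 / 4 ^ k) = 8\<close> points, so each stays empty with probability bounded
  away from 0, while the number of cells grows.\<close>

lemma AE_eventually_empty_cell:
  "AE \<omega> in M. \<forall>\<^sub>F k in sequentially. \<exists>a<2 ^ k. \<forall>i\<in>{1..4 ^ Suc k}.
     P i \<omega> \<notin> {1 / 2 ^ k + real a * (2 / 4 ^ k)<..1 / 2 ^ k + real (Suc a) * (2 / 4 ^ k)}"
proof -
  define D where "D k a = {1 / 2 ^ k + real a * (2 / 4 ^ k)<..1 / 2 ^ k + real (Suc a) * (2 / 4 ^ k)}"
    for k a :: nat
  have [measurable]: "D k a \<in> sets borel" for k a by (simp add: D_def)
  define F where "F k a = {\<omega>\<in>space M. \<forall>i\<in>{1..4 ^ Suc k}. P i \<omega> \<notin> D k a}" for k a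
  have F [measurable]: "F k a \<in> events" for k a unfolding F_def by measurable
  have "AE \<omega> in M. \<forall>\<^sub>F k in sequentially. \<not> (\<forall>a\<in>{..<2 ^ k}. \<omega> \<notin> F k a)"
  proof (rule AE_eventually_not)
    \<comment> \<open>For \<open>k \<ge> 2\<close> the right end \<open>3 / 2 ^ k\<close> of the
      last cell is at most 1, so every cell has its full length as probability.\<close>
    fix k :: nat assume k: "k \<ge> 2"
    define h :: real where "h = 2 / 4 ^ k"
    have "(4::real) ^ k \<ge> 4 ^ 2" using k by (intro power_increasing) auto
    then have h: "0 < h" "h \<le> 1/2" by (auto simp: h_def field_simps)
    have four: "(4::real) ^ k = 2 ^ k * 2 ^ k" by (simp add: power_mult_distrib[symmetric])
    have sub: "D k a \<subseteq> {0..1}" if "a < 2 ^ k" for a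
    proof -
      have "real (Suc a) \<le> 2 ^ k" using that of_nat_mono[of "Suc a" "2 ^ k"] by simp
      then have "1 / 2 ^ k + real (Suc a) * (2 / 4 ^ k) \<le> 1 / 2 ^ k + 2 ^ k * (2 / 4 ^ k)"
        by (intro add_left_mono mult_right_mono) auto
      also have "\<dots> = 3 / 2 ^ k" by (simp add: four field_simps)
      also have "\<dots> \<le> 1"
        using power_increasing[of 2 k "2::real"] k by (simp add: field_simps)
      finally have "1 / 2 ^ k + real (Suc a) * (2 / 4 ^ k) \<le> 1" .
      moreover have "0 \<le> 1 / 2 ^ k + real a * (2 / 4 ^ k)" by simp
      ultimately show ?thesis unfolding D_def
        by (intro subsetI) (simp only: atLeastAtMost_iff greaterThanAtMost_iff, linarith)
    qed
    have len: "measure lborel (D k a) = h" for a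
      by (simp add: D_def h_def field_simps)
    have fin: "emeasure lborel (D k a) < \<infinity>" for a
      unfolding D_def by (intro emeasure_bounded_finite bounded_Ioc)
    define q where "q = (1 - h) ^ 4 ^ Suc k"
    have prob_F: "prob (F k a) = q" if "a \<in> {..<2 ^ k}" for a
      unfolding F_def q_def using sub[of a] that len by (subst prob_all_notin) (auto simp: Int_absorb1)
    \<comment> \<open>Both cells are empty when their disjoint union, of length
      \<open>2 * h\<close>, is missed; \<open>1 - 2 * h\<close> is at most the square of
      \<open>1 - h\<close>.\<close>
    have neg: "prob (F k a \<inter> F k b) \<le> q\<^sup>2" if ab: "a \<in> {..<2 ^ k}" "b \<in> {..<2 ^ k}" "a \<noteq> b" for a b
    proof -
      have disj: "D k a \<inter> D k b = {}" if "a < b" for a b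
      proof -
        have "real (Suc a) * (2 / 4 ^ k) \<le> real b * (2 / 4 ^ k)"
          using that by (intro mult_right_mono) auto
        then show ?thesis by (auto simp: D_def)
      qed
      have "D k a \<inter> D k b = {}"
        using disj[of a b] disj[of b a] ab(3) by (cases "a < b") auto
      then have m: "measure lborel (D k a \<union> D k b) = 2 * h"
        using fin[of a] fin[of b] by (subst measure_Union) (auto simp: len)
      have "F k a \<inter> F k b = {\<omega>\<in>space M. \<forall>i\<in>{1..4 ^ Suc k}. P i \<omega> \<notin> D k a \<union> D k b}"
        by (auto simp: F_def)
      also have "prob \<dots> = (1 - 2 * h) ^ 4 ^ Suc k"
        using sub[of a] sub[of b] ab m by (subst prob_all_notin) (auto simp: Int_absorb1)
      also have "\<dots> \<le> ((1 - h)\<^sup>2) ^ 4 ^ Suc k"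
        using h by (intro power_mono) (auto simp: power2_eq_square algebra_simps)
      also have "\<dots> = q\<^sup>2" unfolding q_def by (simp only: power_mult[symmetric] mult.commute)
      finally show ?thesis .
    qed
    \<comment> \<open>The constant is \<open>2 * h * 4 ^ Suc k = 16\<close>, and
      \<open>exp (- 2 * h) \<le> 1 - h\<close> holds for \<open>h \<le> 1/2\<close>.\<close>
    have "exp (- 16) = exp (- 2 * h) ^ 4 ^ Suc k"
      by (simp add: exp_of_nat_mult[symmetric] h_def)
    also have "\<dots> \<le> q"
      unfolding q_def
    proof (rule power_mono)
      have "- h - 2 * h\<^sup>2 \<le> ln (1 - h)" using h by (intro ln_one_minus_pos_lower_bound) auto
      moreover have "2 * h\<^sup>2 \<le> h" using h by (simp add: power2_eq_square)
      ultimately have "- 2 * h \<le> ln (1 - h)" by linarith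
      then show "exp (- 2 * h) \<le> 1 - h" using h by (subst ln_ge_iff[symmetric]) auto
    qed simp
    finally have q: "exp (- 16) \<le> q" .
    then have q0: "q > 0" using exp_gt_zero[of "-16"] by linarith
    have "prob {\<omega>\<in>space M. \<forall>a\<in>{..<2 ^ k}. \<omega> \<notin> F k a} \<le> 1 / (card {..<(2::nat) ^ k} * q)"
      using q0 prob_F neg by (intro prob_no_event_le) (auto simp: lessThan_empty_iff)
    also have "\<dots> \<le> 1 / (2 ^ k * exp (- 16))"
      using q q0 by (simp, intro divide_left_mono mult_left_mono) auto
    also have "\<dots> = exp 16 / 2 ^ k" by (simp add: exp_minus field_simps)
    finally show "prob {\<omega>\<in>space M. \<forall>a\<in>{..<2 ^ k}. \<omega> \<notin> F k a} \<le> exp 16 / 2 ^ k" .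
  qed measurable
  then show ?thesis
    by (rule AE_mp) (auto intro!: AE_I2 elim!: eventually_mono simp: F_def D_def)
qed

text \<open>All cells end by \<open>3 / 2 ^ k\<close>. The expected number of points up to there is
  at most \<open>12 * 4 ^ k / 2 ^ k\<close>, of smaller order than \<open>4 ^ k\<close>, so Markov's
  inequality gives a summable bound.\<close>

lemma AE_eventually_few_small:
  fixes e :: real
  assumes e: "e > 0"
  shows "AE \<omega> in M. \<forall>\<^sub>F k in sequentially. card {i \<in> {1..4 ^ Suc k}. P i \<omega> \<le> 3 / 2 ^ k} < e * 4 ^ k"
proof -
  define X :: "nat \<Rightarrow> 'a \<Rightarrow> real" where
    "X k \<omega> = (\<Sum>i\<in>{1..4 ^ Suc k}. indicator {\<omega>\<in>space M. P i \<omega> \<in> {..3 / 2 ^ k}} \<omega>)" for k \<omega>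
  have [measurable]: "X k \<in> borel_measurable M" for k unfolding X_def by measurable
  have "AE \<omega> in M. \<forall>\<^sub>F k in sequentially. \<not> X k \<omega> \<ge> e * 4 ^ k"
  proof (rule AE_eventually_not)
    fix k :: nat
    have int: "integrable M (indicator {\<omega>\<in>space M. P i \<omega> \<in> {..3 / 2 ^ k}} :: 'a \<Rightarrow> real)"
      if "i \<in> {1..4 ^ Suc k}" for i
      using that by (auto simp: emeasure_eq_measure)
    have le: "prob {\<omega>\<in>space M. P i \<omega> \<in> {..3 / 2 ^ k}} \<le> 3 / 2 ^ k" if "i \<in> {1..4 ^ Suc k}" for i
    proof -
      have "measure lborel ({0..1} \<inter> {..3 / 2 ^ k :: real}) \<le> measure lborel {0..3 / 2 ^ k :: real}"
        by (intro measure_mono_fmeasurable) (auto simp: fmeasurable_def)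
      then show ?thesis using that by (subst prob_P_in) auto
    qed
    have "expectation (X k) = (\<Sum>i\<in>{1..4 ^ Suc k}. prob {\<omega>\<in>space M. P i \<omega> \<in> {..3 / 2 ^ k}})"
      unfolding X_def using int
      by (subst Bochner_Integration.integral_sum) (auto intro!: sum.cong arg_cong[of _ _ prob])
    also have "\<dots> \<le> (\<Sum>i\<in>{1..4 ^ Suc k :: nat}. 3 / 2 ^ k)" using le by (intro sum_mono)
    also have "\<dots> = 12 * 4 ^ k / 2 ^ k" by simp
    finally have EX: "expectation (X k) \<le> 12 * 4 ^ k / 2 ^ k" .
    have "prob {\<omega>\<in>space M. X k \<omega> \<ge> e * 4 ^ k} \<le> expectation (X k) / (e * 4 ^ k)"
    proof (rule integral_Markov_inequality_measure[where A = "{}"])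
      show "integrable M (X k)" unfolding X_def using int by (intro Bochner_Integration.integrable_sum)
      show "AE \<omega> in M. 0 \<le> X k \<omega>" by (auto simp: X_def intro!: sum_nonneg)
    qed (use e in auto)
    also have "\<dots> \<le> (12 * 4 ^ k / 2 ^ k) / (e * 4 ^ k)" using EX e by (intro divide_right_mono) auto
    also have "\<dots> = (12 / e) / 2 ^ k" using e by simp
    finally show "prob {\<omega>\<in>space M. X k \<omega> \<ge> e * 4 ^ k} \<le> (12 / e) / 2 ^ k" .
  qed measurable
  then show ?thesis
    using AE_space
  proof eventually_elim
    case (elim \<omega>)
    have "X k \<omega> = card {i \<in> {1..4 ^ Suc k}. P i \<omega> \<le> 3 / 2 ^ k}" for k
      using elim(2) by (simp add: X_def indicator_def sum.If_cases Int_def)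
    with elim(1) show ?case by (simp add: not_le)
  qed
qed

section \<open>Almost sure convergence\<close>

text \<open>Each \<open>n\<close> lies in a block from \<open>4 ^ k\<close> to
  \<open>4 ^ Suc k\<close>. The small point is taken from the start of the block, the empty cell and
  the count from its end, so all three pass to \<open>n\<close> by monotonicity.\<close>

lemma AE_eventually_BH_pi0_ge:
  assumes e: "0 < e" "e \<le> 1/2"
  shows "AE \<omega> in M. \<forall>\<^sub>F n in sequentially. BH_pi0 n (\<lambda>i. P i \<omega>) \<ge> 1 - e"
  using AE_P_in AE_eventually_small_point AE_eventually_empty_cell AE_eventually_few_small[OF e(1)]
proof eventually_elim
  case (elim \<omega>)
  from elim(2-4) have "\<forall>\<^sub>F k in sequentially.
      (\<exists>i\<in>{1..4 ^ k}. P i \<omega> \<le> 1 / 2 ^ k) \<and>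
      (\<exists>a<2 ^ k. \<forall>i\<in>{1..4 ^ Suc k}.
         P i \<omega> \<notin> {1 / 2 ^ k + real a * (2 / 4 ^ k)<..1 / 2 ^ k + real (Suc a) * (2 / 4 ^ k)}) \<and>
      card {i \<in> {1..4 ^ Suc k}. P i \<omega> \<le> 3 / 2 ^ k} < e * 4 ^ k"
    by eventually_elim blast
  then obtain k0 where k0: "\<And>k. k \<ge> k0 \<Longrightarrow>
      (\<exists>i\<in>{1..4 ^ k}. P i \<omega> \<le> 1 / 2 ^ k) \<and>
      (\<exists>a<2 ^ k. \<forall>i\<in>{1..4 ^ Suc k}.
         P i \<omega> \<notin> {1 / 2 ^ k + real a * (2 / 4 ^ k)<..1 / 2 ^ k + real (Suc a) * (2 / 4 ^ k)}) \<and>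
      card {i \<in> {1..4 ^ Suc k}. P i \<omega> \<le> 3 / 2 ^ k} < e * 4 ^ k"
    unfolding eventually_sequentially by blast
  show ?case
    unfolding eventually_sequentially
  proof (intro exI allI impI)
    fix n :: nat assume n: "n \<ge> 4 ^ k0"
    then have n1: "n \<ge> 1" using one_le_power[of "4::nat" k0] by linarith
    obtain k where k: "4 ^ k \<le> n" "n < 4 ^ Suc k"
      using ex_power_ivl1[of 4 n] n1 by auto
    have "(4::nat) ^ k0 < 4 ^ Suc k" using n k by linarith
    then have "k0 \<le> k" using power_less_imp_less_exp[of "4::nat" k0 "Suc k"] by simp
    from k0[OF this] obtain l a where
      l: "l \<in> {1..4 ^ k}" "P l \<omega> \<le> 1 / 2 ^ k" and
      a: "a < 2 ^ k" "\<And>i. i \<in> {1..4 ^ Suc k} \<Longrightarrow>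
         P i \<omega> \<notin> {1 / 2 ^ k + real a * (2 / 4 ^ k)<..1 / 2 ^ k + real (Suc a) * (2 / 4 ^ k)}" and
      few: "card {i \<in> {1..4 ^ Suc k}. P i \<omega> \<le> 3 / 2 ^ k} < e * 4 ^ k"
      by blast
    \<comment> \<open>The left end of the empty cell serves as the left end of the gap.\<close>
    define u where "u = 1 / 2 ^ k + real a * (2 / 4 ^ k)"
    have n_ge: "real n \<ge> 4 ^ k" using of_nat_mono[OF k(1), where ?'a = real] by simp
    have four: "(4::real) ^ k = 2 ^ k * 2 ^ k" by (simp add: power_mult_distrib[symmetric])
    have "real a \<le> 2 ^ k" using a(1) of_nat_mono[of a "2 ^ k"] by simp
    then have "u \<le> 1 / 2 ^ k + 2 ^ k * (2 / 4 ^ k)"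
      unfolding u_def by (intro add_left_mono mult_right_mono) auto
    also have "\<dots> = 3 / 2 ^ k" by (simp add: four field_simps)
    finally have u: "u \<le> 3 / 2 ^ k" .
    show "BH_pi0 n (\<lambda>i. P i \<omega>) \<ge> 1 - e"
    proof (rule BH_pi0_ge)
      show "P i \<omega> \<in> {0..1}" if "i \<in> {1..n}" for i using elim(1) that by auto
      show "\<exists>i\<in>{1..n}. P i \<omega> \<le> u"
      proof
        show "P l \<omega> \<le> u" using l(2) by (simp add: u_def add_increasing2)
      qed (use l k in auto)
      \<comment> \<open>As \<open>4 ^ k \<le> n\<close>, a gap of length \<open>2 / n\<close> fits
        into the cell.\<close>
      have "2 / real n \<le> 2 / 4 ^ k" using n_ge by (intro divide_left_mono) (use n1 in auto)
      then have "u + 2 / n \<le> 1 / 2 ^ k + real (Suc a) * (2 / 4 ^ k)"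
        by (simp add: u_def algebra_simps add_divide_distrib)
      then show "P i \<omega> \<notin> {u<..u + 2 / n}" if "i \<in> {1..n}" for i
        using a(2)[of i] that k by (auto simp: u_def)
      have "card {i \<in> {1..n}. P i \<omega> \<le> u} \<le> card {i \<in> {1..4 ^ Suc k}. P i \<omega> \<le> 3 / 2 ^ k}"
        using u k by (intro card_mono) auto
      then have "real (card {i \<in> {1..n}. P i \<omega> \<le> u}) \<le> e * 4 ^ k" using few by linarith
      also have "\<dots> \<le> e * n" using n_ge e by simp
      finally show "card {i \<in> {1..n}. P i \<omega> \<le> u} \<le> e * n" .
    qed (use n1 e in auto)
  qed
qed

end

theorem theorem3p2:
  fixes M :: "'a measure" and P :: "nat \<Rightarrow> 'a \<Rightarrow> real"
  assumes "prob_space M"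
    and "prob_space.indep_vars M (\<lambda>_. borel) P {1..}"
    and "\<And>i. i \<ge> 1 \<Longrightarrow> distr M borel (P i) = uniform_measure lborel {0..1}"
  shows "AE \<omega> in M. (\<lambda>n. BH_pi0 n (\<lambda>i. P i \<omega>)) \<longlonglongrightarrow> 1"
proof -
  interpret iid_uniform M P
    using assms by (simp add: iid_uniform_def iid_uniform_axioms_def)
  \<comment> \<open>Countably many levels allow one common null set; the shift by 2 keeps each level
    at most \<open>1/2\<close>.\<close>
  have "AE \<omega> in M. \<forall>r::nat. \<forall>\<^sub>F n in sequentially. BH_pi0 n (\<lambda>i. P i \<omega>) \<ge> 1 - 1 / (real r + 2)"
    unfolding AE_all_countable by (intro allI AE_eventually_BH_pi0_ge) (auto simp: field_simps)
  then show ?thesis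
  proof eventually_elim
    case (elim \<omega>)
    show ?case
    proof (rule tendstoI)
      fix d :: real assume "d > 0"
      then obtain r :: nat where "inverse (real (Suc r)) < d" using reals_Archimedean by blast
      moreover have "1 / (real r + 2) \<le> inverse (real (Suc r))" by (simp add: field_simps)
      ultimately have r: "1 / (real r + 2) < d" by linarith
      from elim have "\<forall>\<^sub>F n in sequentially. BH_pi0 n (\<lambda>i. P i \<omega>) \<ge> 1 - 1 / (real r + 2)" by blast
      then show "\<forall>\<^sub>F n in sequentially. dist (BH_pi0 n (\<lambda>i. P i \<omega>)) 1 < d"
        using eventually_gt_at_top[of 0]
      proof eventually_elim
        case (elim n)
        then show ?case using BH_pi0_le_1[of n "\<lambda>i. P i \<omega>"] r by (auto simp: dist_real_def)
      qed
    qed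
  qed
qed

end
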